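(* Let $P$ be a FASP program, let $\mathcal{L}$ be the set of all loops of $P$, and let $\mathbb{LF}(P)=\{\mathbb{LF}(L,P)\mid L\in\mathcal{L}\}$ be the set of loop formulas of all loops of $P$. Then for any answer set $I$ of $P$ it holds that $I\models \mathbb{LF}(P)\cup comp(P)$, where $comp(P)$ is the completion of $P$.
   Context: "Increasing" and "decreasing" are meant in the non-strict sense. A t-norm is an increasing, commutative, associative map $\mathcal{T}:[0,1]^2\to[0,1]$ with $\mathcal{T}(1,x)=x$ for all $x$; all t-norms are assumed left-continuous. The residual implicator of $\mathcal{T}$ is $\mathcal{I}(x,y)=\sup\{\lambda\in[0,1]\mid \mathcal{T}(x,\lambda)\le y\}$, and its biresiduum is $x\approx y=\mathcal{T}(\mathcal{I}(x,y),\mathcal{I}(y,x))$. A negator is a decreasing map $\mathcal{N}:[0,1]\to[0,1]$ with $\mathcal{N}(0)=1$, $\mathcal{N}(1)=0$. FASP programs. A literal is either an atom or a constant from $[0,1]$. An extended literal is either a literal (positive extended literal) or an expression $\mathcal{N}(a)$ with $a$ an atom and $\mathcal{N}$ an arbitrary negator (negative extended literal). A rule $r$ has the form $a\leftarrow \mathcal{T}(b_1,\ldots,b_n)$ with $n>0$, $a$ a literal (the head $H(r)$), $b_1,\ldots,b_n$ extended literals (forming the body $B(r)$) and $\mathcal{T}$ an arbitrary t-norm, where $\mathcal{T}(b)=b$ and $\mathcal{T}(b_1,\ldots,b_n)=\mathcal{T}(b_1,\mathcal{T}(b_2,\ldots))$. The t-norm and the negators may differ from rule to rule. $Lit^+(B(r))$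 is the set of positive extended literals in the body of $r$, and $\mathcal{I}_r$ is the residual implicator of the t-norm in the body of $r$. A FASP program $P$ is a finite set of rules; $\mathcal{B}_P$ is the finite set of all atoms occurring in $P$; for an atom $a$, $P_a$ is the set of rules of $P$ with head $a$. Interpretations. An interpretation $I$ of $P$ is a map $I:\mathcal{B}_P\to[0,1]$, extended by $I(c)=c$ for $c\in[0,1]$, $I(\mathcal{N}(a))=\mathcal{N}(I(a))$, $I(B(r))=\mathcal{T}(I(b_1),\ldots,I(b_n))$ and $I(r)=\mathcal{I}_r(I(B(r)),I(H(r)))$ for a rule $r: a\leftarrow\mathcal{T}(b_1,\ldots,b_n)$. $I$ is a model of $P$ iff $I(r)=1$ for every $r\in P$. The support is $supp(I)=\{a\in\mathcal{B}_P\mid I(a)>0\}$. Answer sets. A set $U\subseteq\mathcal{B}_P$ is unfounded w.r.t. $I$ iff for each $u\in U$ and each $r\in P_u$ at least one of the following holds: (1) $U\cap Lit^+(B(r))\ne\emptyset$; (2) $I(u)>I(B(r))$; (3) $I(B(r))=0$. $I$ is unfounded-free iff $supp(I)\cap U=\emptyset$ for every set $U$ unfounded w.r.t. $I$. An answer set of $P$ is a model of $P$ that is unfounded-free. Completion. Interpretations are extended truth-functionally to fuzzy formulas built from atoms, constants and connectives; $I\models F$ iff $I(F)=1$, and $I\models\Theta$ for a set $\Theta$ iff $I\models F$ for all $F\in\Theta$. The completion $comp(P)$ is the set of formulas $$\{a\approx \max\{B(r)\mid r\in P_a\}\mid a\in\mathcal{B}_P\}\cup\{\mathcal{I}_r(B(r),H(r))\mid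 r\in P,\ H(r)\in[0,1]\},$$ where $\approx$ is the biresiduum of an arbitrary residual implicator, $B(r)$ as a formula denotes $\mathcal{T}(b_1,\ldots,b_n)$, and $\max\emptyset=0$. Loops and loop formulas. The positive dependency graph of $P$ is the directed graph $G_P$ on $\mathcal{B}_P$ with an edge $(a,b)$ iff there is $r\in P_a$ with $b\in Lit^+(B(r))$. A non-empty set $L\subseteq\mathcal{B}_P$ is a loop of $P$ iff for all $a,b\in L$ there is a path of length $>0$ from $a$ to $b$ in $G_P$ all of whose vertices lie in $L$. For a loop $L=\{l_1,\ldots,l_m\}$ let $R^-_P(L)=\{r\in P\mid H(r)\in L,\ Lit^+(B(r))\cap L=\emptyset\}=\{r_1,\ldots,r_n\}$. The loop formula $\mathbb{LF}(L,P)$ is $\mathcal{I}(\max(l_1,\ldots,l_m),\max(B(r_1),\ldots,B(r_n)))$, where $\mathcal{I}$ is an arbitrary residual implicator; if $R^-_P(L)=\emptyset$ it is $\mathcal{I}(\max(l_1,\ldots,l_m),0)$. *)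

theory Defs
  imports Complex_Main "HOL-Library.FSet"
begin

text \<open>
  Operations on the unit interval are functions on the reals, constrained only on
  \<open>{0..1}\<close>; their values elsewhere are irrelevant.
\<close>

text \<open>
  T-norms are left-continuous throughout. For monotone commutative maps, left-continuity
  in the second argument amounts to left-continuity in both. The filter \<open>at y within {0..<y}\<close>
  keeps the limit inside the unit interval (and makes the condition void at 0).
\<close>

definition tnorm :: "(real \<Rightarrow> real \<Rightarrow> real) \<Rightarrow> bool" where
  "tnorm T \<longleftrightarrow>
     (\<forall>x\<in>{0..1}. \<forall>y\<in>{0..1}. T x y \<in> {0..1}) \<and>
     (\<forall>x\<in>{0..1}. \<forall>x'\<in>{0..1}. \<forall>y\<in>{0..1}. \<forall>y'\<in>{0..1}.
        x \<le> x' \<longrightarrow> y \<le> y' \<longrightarrow> T x y \<le> T x' y') \<and>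
     (\<forall>x\<in>{0..1}. \<forall>y\<in>{0..1}. T x y = T y x) \<and>
     (\<forall>x\<in>{0..1}. \<forall>y\<in>{0..1}. \<forall>z\<in>{0..1}. T (T x y) z = T x (T y z)) \<and>
     (\<forall>x\<in>{0..1}. T 1 x = x) \<and>
     (\<forall>x\<in>{0..1}. \<forall>y\<in>{0..1}. (T x \<longlongrightarrow> T x y) (at y within {0..<y}))"

definition residual :: "(real \<Rightarrow> real \<Rightarrow> real) \<Rightarrow> real \<Rightarrow> real \<Rightarrow> real" where
  "residual T x y = Sup {l \<in> {0..1}. T x l \<le> y}"

definition biresiduum :: "(real \<Rightarrow> real \<Rightarrow> real) \<Rightarrow> real \<Rightarrow> real \<Rightarrow> real" where
  "biresiduum T x y = T (residual T x y) (residual T y x)"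

definition negator :: "(real \<Rightarrow> real) \<Rightarrow> bool" where
  "negator N \<longleftrightarrow>
     (\<forall>x\<in>{0..1}. N x \<in> {0..1}) \<and>
     (\<forall>x\<in>{0..1}. \<forall>y\<in>{0..1}. x \<le> y \<longrightarrow> N y \<le> N x) \<and>
     N 0 = 1 \<and> N 1 = 0"


text \<open>
  The set function \<open>rule_atoms\<close> generated by the datatype package yields the atoms
  occurring anywhere in a rule: in its head, and positively or under a negator in its body.
\<close>

datatype 'a literal = Atom 'a | Const real

datatype 'a ext_literal = Pos "'a literal" | Neg "real \<Rightarrow> real" 'a

datatype (rule_atoms: 'a) rule =
  Rule (head: "'a literal") (rule_tnorm: "real \<Rightarrow> real \<Rightarrow> real") (body: "'a ext_literal list")

fun wf_literal :: "'a literal \<Rightarrow> bool" where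
  "wf_literal (Atom a) \<longleftrightarrow> True"
| "wf_literal (Const c) \<longleftrightarrow> c \<in> {0..1}"

fun wf_ext_literal :: "'a ext_literal \<Rightarrow> bool" where
  "wf_ext_literal (Pos l) \<longleftrightarrow> wf_literal l"
| "wf_ext_literal (Neg N a) \<longleftrightarrow> negator N"

definition wf_rule :: "'a rule \<Rightarrow> bool" where
  "wf_rule r \<longleftrightarrow>
     wf_literal (head r) \<and> tnorm (rule_tnorm r) \<and>
     body r \<noteq> [] \<and> (\<forall>b\<in>set (body r). wf_ext_literal b)"

definition fasp_program :: "'a rule fset \<Rightarrow> bool" where
  "fasp_program P \<longleftrightarrow> (\<forall>r\<in>fset P. wf_rule r)"

definition atoms :: "'a rule fset \<Rightarrow> 'a set" where
  "atoms P = (\<Union>r\<in>fset P. rule_atoms r)"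

definition rules_for :: "'a rule fset \<Rightarrow> 'a \<Rightarrow> 'a rule fset" where
  "rules_for P a = ffilter (\<lambda>r. head r = Atom a) P"

definition pos_lits :: "'a rule \<Rightarrow> 'a literal set" where
  "pos_lits r = {l. Pos l \<in> set (body r)}"


text \<open>
  Fuzzy formulas. \<open>FImp T\<close> and \<open>FEquiv T\<close> stand for the residual implicator and
  the biresiduum of \<open>T\<close>; the maximum of the empty set of formulas has value 0.
\<close>

datatype 'a formula =
    FAtom 'a
  | FConst real
  | FNeg "real \<Rightarrow> real" "'a formula"
  | FConj "real \<Rightarrow> real \<Rightarrow> real" "'a formula" "'a formula"
  | FImp "real \<Rightarrow> real \<Rightarrow> real" "'a formula" "'a formula"
  | FEquiv "real \<Rightarrow> real \<Rightarrow> real" "'a formula" "'a formula"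
  | FMax "'a formula fset"

primrec val :: "('a \<Rightarrow> real) \<Rightarrow> 'a formula \<Rightarrow> real" where
  "val I (FAtom a) = I a"
| "val I (FConst c) = c"
| "val I (FNeg N F) = N (val I F)"
| "val I (FConj T F G) = T (val I F) (val I G)"
| "val I (FImp T F G) = residual T (val I F) (val I G)"
| "val I (FEquiv T F G) = biresiduum T (val I F) (val I G)"
| "val I (FMax Fs) = (if Fs = {||} then 0 else fMax (val I |`| Fs))"

definition satisfies :: "('a \<Rightarrow> real) \<Rightarrow> 'a formula set \<Rightarrow> bool" where
  "satisfies I \<Theta> \<longleftrightarrow> (\<forall>F\<in>\<Theta>. val I F = 1)"

fun literal_formula :: "'a literal \<Rightarrow> 'a formula" where
  "literal_formula (Atom a) = FAtom a"
| "literal_formula (Const c) = FConst c"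

fun ext_literal_formula :: "'a ext_literal \<Rightarrow> 'a formula" where
  "ext_literal_formula (Pos l) = literal_formula l"
| "ext_literal_formula (Neg N a) = FNeg N (FAtom a)"

text \<open>The value for the empty list is a dummy: bodies of well-formed rules are non-empty.\<close>

fun conj_formula :: "(real \<Rightarrow> real \<Rightarrow> real) \<Rightarrow> 'a ext_literal list \<Rightarrow> 'a formula" where
  "conj_formula T [] = FConst 1"
| "conj_formula T [b] = ext_literal_formula b"
| "conj_formula T (b # c # bs) = FConj T (ext_literal_formula b) (conj_formula T (c # bs))"

definition body_formula :: "'a rule \<Rightarrow> 'a formula" where
  "body_formula r = conj_formula (rule_tnorm r) (body r)"

definition rule_formula :: "'a rule \<Rightarrow> 'a formula" where
  "rule_formula r = FImp (rule_tnorm r) (body_formula r) (literal_formula (head r))"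


text \<open>
  An interpretation is a total function on the type of atoms, of which only the values on
  the atoms of the program matter.
\<close>

definition interpretation_of :: "'a rule fset \<Rightarrow> ('a \<Rightarrow> real) \<Rightarrow> bool" where
  "interpretation_of P I \<longleftrightarrow> (\<forall>a\<in>atoms P. I a \<in> {0..1})"

definition model :: "'a rule fset \<Rightarrow> ('a \<Rightarrow> real) \<Rightarrow> bool" where
  "model P I \<longleftrightarrow> interpretation_of P I \<and> (\<forall>r\<in>fset P. val I (rule_formula r) = 1)"

definition supp :: "'a rule fset \<Rightarrow> ('a \<Rightarrow> real) \<Rightarrow> 'a set" where
  "supp P I = {a \<in> atoms P. I a > 0}"

definition unfounded :: "'a rule fset \<Rightarrow> ('a \<Rightarrow> real) \<Rightarrow> 'a set \<Rightarrow> bool" where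
  "unfounded P I U \<longleftrightarrow>
     U \<subseteq> atoms P \<and>
     (\<forall>u\<in>U. \<forall>r\<in>fset (rules_for P u).
        Atom ` U \<inter> pos_lits r \<noteq> {} \<or>
        I u > val I (body_formula r) \<or>
        val I (body_formula r) = 0)"

definition unfounded_free :: "'a rule fset \<Rightarrow> ('a \<Rightarrow> real) \<Rightarrow> bool" where
  "unfounded_free P I \<longleftrightarrow> (\<forall>U. unfounded P I U \<longrightarrow> supp P I \<inter> U = {})"

definition answer_set :: "'a rule fset \<Rightarrow> ('a \<Rightarrow> real) \<Rightarrow> bool" where
  "answer_set P I \<longleftrightarrow> model P I \<and> unfounded_free P I"


text \<open>\<open>T\<close> is the t-norm whose biresiduum is used for the equivalences.\<close>

definition completion :: "(real \<Rightarrow> real \<Rightarrow> real) \<Rightarrow> 'a rule fset \<Rightarrow> 'a formula set" where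
  "completion T P =
     {FEquiv T (FAtom a) (FMax (body_formula |`| rules_for P a)) | a. a \<in> atoms P} \<union>
     {FImp (rule_tnorm r) (body_formula r) (FConst c) | r c. r \<in> fset P \<and> head r = Const c}"

definition dependency_graph :: "'a rule fset \<Rightarrow> ('a \<times> 'a) set" where
  "dependency_graph P = {(a, b). \<exists>r\<in>fset (rules_for P a). Atom b \<in> pos_lits r}"

definition loop :: "'a rule fset \<Rightarrow> 'a fset \<Rightarrow> bool" where
  "loop P L \<longleftrightarrow>
     L \<noteq> {||} \<and> fset L \<subseteq> atoms P \<and>
     (\<forall>a\<in>fset L. \<forall>b\<in>fset L. (a, b) \<in> (dependency_graph P \<inter> fset L \<times> fset L)\<^sup>+)"

definition external_rules :: "'a rule fset \<Rightarrow> 'a fset \<Rightarrow> 'a rule fset" where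
  "external_rules P L =
     ffilter (\<lambda>r. head r \<in> Atom ` fset L \<and> pos_lits r \<inter> Atom ` fset L = {}) P"

definition loop_formula ::
    "(real \<Rightarrow> real \<Rightarrow> real) \<Rightarrow> 'a fset \<Rightarrow> 'a rule fset \<Rightarrow> 'a formula" where
  "loop_formula T L P =
     FImp T (FMax (FAtom |`| L))
       (if external_rules P L = {||} then FConst 0
        else FMax (body_formula |`| external_rules P L))"

text \<open>
  The residual implicator may be chosen separately for each loop: \<open>S L\<close> is the t-norm
  whose implicator is used in the loop formula of \<open>L\<close>.
\<close>

definition loop_formulas ::
    "('a fset \<Rightarrow> real \<Rightarrow> real \<Rightarrow> real) \<Rightarrow> 'a rule fset \<Rightarrow> 'a formula set" where
  "loop_formulas S P = {loop_formula (S L) L P | L. loop P L}"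

end

theory Submission
  imports Defs
begin

text \<open>
  A model satisfies \<open>I(B(r)) \<le> I(a)\<close> for every rule \<open>r\<close> with head \<open>a\<close>, so only the upper
  bounds on \<open>I\<close> need unfounded-freeness. If \<open>I(a)\<close> exceeded the value of every body in
  \<open>P\<^sub>a\<close>, then \<open>{a}\<close> would be unfounded. If some atom of a loop \<open>L\<close> had a value above the
  maximum \<open>e\<close> of the external bodies of \<open>L\<close>, then \<open>{u \<in> L. I(u) > e}\<close> would be
  unfounded: a body containing an atom \<open>l \<in> L\<close> outside this set has value at most
  \<open>I(l) \<le> e\<close>.
\<close>

section \<open>T-norms and their residual implicators\<close>

lemma tnorm_range:
  assumes "tnorm T" "x \<in> {0..1}" "y \<in> {0..1}"
  shows "T x y \<in> {0..1}"
  using assms unfolding tnorm_def by blast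

lemma tnorm_mono:
  assumes "tnorm T" "x \<in> {0..1}" "x' \<in> {0..1}" "y \<in> {0..1}" "y' \<in> {0..1}" "x \<le> x'" "y \<le> y'"
  shows "T x y \<le> T x' y'"
  using assms unfolding tnorm_def by blast

lemma tnorm_commute:
  assumes "tnorm T" "x \<in> {0..1}" "y \<in> {0..1}"
  shows "T x y = T y x"
  using assms unfolding tnorm_def by blast

lemma tnorm_left_unit:
  assumes "tnorm T" "x \<in> {0..1}"
  shows "T 1 x = x"
  using assms unfolding tnorm_def by blast

lemma tnorm_right_unit:
  assumes "tnorm T" "x \<in> {0..1}"
  shows "T x 1 = x"
  using tnorm_commute[OF assms, of 1] tnorm_left_unit[OF assms] by simp

lemma tnorm_le_right:
  assumes "tnorm T" "x \<in> {0..1}" "y \<in> {0..1}"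
  shows "T x y \<le> y"
  using tnorm_mono[OF assms(1,2), of 1 y y] tnorm_left_unit[OF assms(1,3)] assms by simp

lemma tnorm_le_left:
  assumes "tnorm T" "x \<in> {0..1}" "y \<in> {0..1}"
  shows "T x y \<le> x"
  using tnorm_le_right[OF assms(1,3,2)] tnorm_commute[OF assms] by simp

lemma tnorm_left_continuous:
  assumes "tnorm T" "x \<in> {0..1}" "y \<in> {0..1}"
  shows "(T x \<longlongrightarrow> T x y) (at y within {0..<y})"
  using assms unfolding tnorm_def by blast

text \<open>Left-continuity matters for the direction from left to right: a supremum equal to 1
  first gives the bound \<open>y\<close> only at arguments below 1, and the left limit carries it to
  \<open>T x 1 = x\<close>.\<close>

lemma residual_eq_1_iff:
  assumes T: "tnorm T" and x: "x \<in> {0..1}" and y: "y \<in> {0..1}"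
  shows "residual T x y = 1 \<longleftrightarrow> x \<le> y"
proof
  let ?A = "{l \<in> {0..1}. T x l \<le> y}"
  have bdd: "bdd_above ?A" by (rule bdd_aboveI[of _ 1]) auto
  have "0 \<in> ?A" using tnorm_le_right[OF T x, of 0] y by auto
  then have ne: "?A \<noteq> {}" by blast
  { assume "x \<le> y"
    then have "1 \<in> ?A" using tnorm_right_unit[OF T x] by simp
    then show "residual T x y = 1"
      unfolding residual_def by (intro cSup_eq_maximum) auto
  }
  assume "residual T x y = 1"
  then have sup: "Sup ?A = 1" by (simp add: residual_def)
  \<comment> \<open>By monotonicity of \<open>T\<close>, \<open>?A\<close> is closed downwards, so
    it contains every point of the unit interval strictly below its supremum.\<close>
  have below: "T x l \<le> y" if "l \<in> {0..<1}" for l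
  proof -
    have "l < Sup ?A" using that sup by simp
    then obtain l' where l': "l' \<in> ?A" "l < l'"
      using ne by (rule less_cSupE)
    then have "T x l \<le> T x l'" using that x by (intro tnorm_mono[OF T]) auto
    with l' show ?thesis by simp
  qed
  have "T x 1 \<le> y"
  proof (rule tendsto_upperbound[OF tnorm_left_continuous[OF T x]])
    show "\<forall>\<^sub>F l in at 1 within {0..<1}. T x l \<le> y"
      using below by (auto simp: eventually_at_filter)
    \<comment> \<open>A bound passes to the limit only along a proper filter. Near 1 the constraint
      of being at least 0 is void, so this filter is the usual left neighbourhood filter.\<close>
    have "at (1::real) within {0..<1} = at_left 1"
      by (rule at_within_nhd[where S = "{0<..}"]) auto
    then show "at (1::real) within {0..<1} \<noteq> bot"
      by simp
  qed simp
  then show "x \<le> y" using tnorm_right_unit[OF T x] by simp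
qed

lemma biresiduum_self:
  assumes "tnorm T" "x \<in> {0..1}"
  shows "biresiduum T x x = 1"
  using assms residual_eq_1_iff[OF assms assms(2)] tnorm_left_unit[OF assms(1), of 1]
  by (simp add: biresiduum_def)

section \<open>Values of maxima, conjunctions and literals\<close>

lemma val_le_val_FMax:
  assumes "F |\<in>| Fs"
  shows "val I F \<le> val I (FMax Fs)"
  using assms by (auto intro: fMax_ge)

lemma val_FMax_attained:
  assumes "Fs \<noteq> {||}"
  obtains F where "F |\<in>| Fs" "val I (FMax Fs) = val I F"
proof -
  have "fMax (val I |`| Fs) |\<in>| val I |`| Fs" using assms by (intro fMax_in) auto
  then show thesis using assms that by auto
qed

lemma val_FMax_range:
  assumes "\<And>F. F |\<in>| Fs \<Longrightarrow> val I F \<in> {0..1}"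
  shows "val I (FMax Fs) \<in> {0..1}"
proof (cases "Fs = {||}")
  case False
  then show ?thesis using assms by (metis val_FMax_attained)
qed simp

lemma val_conj_formula_range:
  assumes "tnorm T" "\<And>b. b \<in> set bs \<Longrightarrow> val I (ext_literal_formula b) \<in> {0..1}"
  shows "val I (conj_formula T bs) \<in> {0..1}"
  using assms(2)
proof (induction bs rule: induct_list012)
  case (3 b c bs)
  then have "val I (ext_literal_formula b) \<in> {0..1}" "val I (conj_formula T (c # bs)) \<in> {0..1}"
    by (simp, meson list.set_intros)
  then show ?case using tnorm_range[OF assms(1)] by simp
qed auto

text \<open>Since 1 is the unit and \<open>T\<close> is monotone, \<open>T\<close> lies below both
  of its arguments; this propagates along the nested conjunction.\<close>

lemma val_conj_formula_le:
  assumes "tnorm T" "\<And>b. b \<in> set bs \<Longrightarrow> val I (ext_literal_formula b) \<in> {0..1}"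
    and "b \<in> set bs"
  shows "val I (conj_formula T bs) \<le> val I (ext_literal_formula b)"
  using assms(2,3)
proof (induction bs rule: induct_list012)
  case (3 c d bs)
  let ?F = "conj_formula T (d # bs)"
  have c: "val I (ext_literal_formula c) \<in> {0..1}"
    using "3.prems"(1) by simp
  have rest: "val I ?F \<in> {0..1}"
    using "3.prems"(1) by (intro val_conj_formula_range[OF assms(1)]) auto
  show ?case
  proof (cases "b = c")
    case True
    then show ?thesis using tnorm_le_left[OF assms(1) c rest] by simp
  next
    case False
    then have "val I ?F \<le> val I (ext_literal_formula b)"
      using "3.prems" by (intro "3.IH"(2)) auto
    then show ?thesis using tnorm_le_right[OF assms(1) c rest] by simp
  qed
qed auto

lemma val_literal_range:
  assumes "wf_literal l" "\<And>a. a \<in> set_literal l \<Longrightarrow> I a \<in> {0..1}"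
  shows "val I (literal_formula l) \<in> {0..1}"
  using assms by (cases l) auto

lemma val_ext_literal_range:
  assumes "wf_ext_literal b" "\<And>a. a \<in> set_ext_literal b \<Longrightarrow> I a \<in> {0..1}"
  shows "val I (ext_literal_formula b) \<in> {0..1}"
proof (cases b)
  case (Pos l)
  then show ?thesis using assms val_literal_range[of l I] by simp
next
  case (Neg N a)
  then show ?thesis using assms by (simp add: negator_def)
qed

section \<open>Rules evaluated under a fixed interpretation\<close>

locale program_interpretation =
  fixes P :: "'a rule fset" and I :: "'a \<Rightarrow> real"
  assumes program: "fasp_program P" and interp: "interpretation_of P I"
begin

lemma wf_ruleI:
  assumes "r \<in> fset P"
  shows "wf_rule r"
  using assms program unfolding fasp_program_def by blast

lemma atom_range:
  assumes "r \<in> fset P" "a \<in> rule_atoms r"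
  shows "I a \<in> {0..1}"
  using assms interp unfolding interpretation_of_def atoms_def by blast

lemma head_range:
  assumes "r \<in> fset P"
  shows "val I (literal_formula (head r)) \<in> {0..1}"
  using wf_ruleI[OF assms] atom_range[OF assms]
  by (intro val_literal_range) (auto simp: wf_rule_def rule.set_sel)

lemma ext_literal_range:
  assumes "r \<in> fset P" "b \<in> set (body r)"
  shows "val I (ext_literal_formula b) \<in> {0..1}"
  using assms wf_ruleI[OF assms(1)] atom_range[OF assms(1)]
  by (intro val_ext_literal_range) (auto simp: wf_rule_def rule.set_sel)

lemma body_range:
  assumes "r \<in> fset P"
  shows "val I (body_formula r) \<in> {0..1}"
  unfolding body_formula_def
  using assms wf_ruleI[OF assms] ext_literal_range
  by (intro val_conj_formula_range) (auto simp: wf_rule_def)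

text \<open>This controls the rules of a loop that are not external: a positive atom of the body
  caps the value of the whole body.\<close>

lemma body_le_pos_atom:
  assumes "r \<in> fset P" "Atom a \<in> pos_lits r"
  shows "val I (body_formula r) \<le> I a"
proof -
  have "val I (body_formula r) \<le> val I (ext_literal_formula (Pos (Atom a)))"
    unfolding body_formula_def
    using assms wf_ruleI[OF assms(1)] ext_literal_range[OF assms(1)]
    by (intro val_conj_formula_le) (auto simp: wf_rule_def pos_lits_def)
  then show ?thesis by simp
qed

lemma rule_satisfied_iff:
  assumes "r \<in> fset P"
  shows "val I (rule_formula r) = 1 \<longleftrightarrow>
    val I (body_formula r) \<le> val I (literal_formula (head r))"
  using residual_eq_1_iff[OF _ body_range[OF assms] head_range[OF assms]] wf_ruleI[OF assms]
  by (simp add: rule_formula_def wf_rule_def)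

section \<open>Upper bounds from unfounded-freeness\<close>

lemma atom_le_FMax_rules:
  assumes "unfounded_free P I" "a \<in> atoms P"
  shows "I a \<le> val I (FMax (body_formula |`| rules_for P a))" (is "_ \<le> val I (FMax ?Fs)")
proof (rule ccontr)
  assume "\<not> ?thesis"
  then have less: "val I (FMax ?Fs) < I a" by simp
  \<comment> \<open>The maximum is at least 0, also when \<open>a\<close> has no rules and it takes
    the default value, so \<open>I a\<close> is positive.\<close>
  have "val I (FMax ?Fs) \<in> {0..1}"
    using body_range by (intro val_FMax_range) (auto simp: rules_for_def)
  then have "a \<in> supp P I" using less assms(2) by (simp add: supp_def del: val.simps)
  moreover have "unfounded P I {a}"
    unfolding unfounded_def
  proof (intro conjI ballI)
    fix u r assume "u \<in> {a}" "r \<in> fset (rules_for P u)"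
    then have "val I (body_formula r) < I u"
      using less val_le_val_FMax[of "body_formula r" ?Fs I] by simp
    then show "Atom ` {a} \<inter> pos_lits r \<noteq> {} \<or> val I (body_formula r) < I u \<or>
        val I (body_formula r) = 0"
      by blast
  qed (use assms(2) in simp)
  ultimately show False using assms(1) unfolding unfounded_free_def by blast
qed

lemma loop_atom_le_FMax_external:
  assumes "unfounded_free P I" "fset L \<subseteq> atoms P" "a \<in> fset L"
  shows "I a \<le> val I (FMax (body_formula |`| external_rules P L))" (is "_ \<le> val I (FMax ?Fs)")
proof (rule ccontr)
  define e where "e = val I (FMax ?Fs)"
  define U where "U = {u \<in> fset L. e < I u}"
  assume "\<not> ?thesis"
  then have "a \<in> U" using assms(3) by (simp add: U_def e_def del: val.simps)
  have "e \<in> {0..1}"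
    unfolding e_def using body_range by (intro val_FMax_range) (auto simp: external_rules_def)
  then have "a \<in> supp P I" using \<open>a \<in> U\<close> assms(2) by (auto simp: supp_def U_def)
  moreover have "unfounded P I U"
    unfolding unfounded_def
  proof (intro conjI ballI)
    show "U \<subseteq> atoms P" using assms(2) by (auto simp: U_def)
    fix u r assume u: "u \<in> U" and "r \<in> fset (rules_for P u)"
    then have r: "r \<in> fset P" "head r = Atom u" by (auto simp: rules_for_def)
    show "Atom ` U \<inter> pos_lits r \<noteq> {} \<or> val I (body_formula r) < I u \<or>
        val I (body_formula r) = 0"
    proof (cases "Atom ` U \<inter> pos_lits r = {}")
      case True
      have "val I (body_formula r) \<le> e"
      proof (cases "r |\<in>| external_rules P L")
        case True
        then show ?thesis unfolding e_def by (intro val_le_val_FMax) simp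
      next
        \<comment> \<open>The head of \<open>r\<close> lies in \<open>L\<close>, so \<open>r\<close>
          fails to be external only through a positive body atom \<open>l\<close> in
          \<open>L\<close>. As \<open>U\<close> misses the positive body of \<open>r\<close>,
          \<open>l\<close> is outside \<open>U\<close>, which means
          \<open>I l \<le> e\<close>.\<close>
        case False
        then obtain l where l: "l \<in> fset L" "Atom l \<in> pos_lits r"
          using r u by (auto simp: external_rules_def U_def)
        with True have "I l \<le> e" by (force simp: U_def)
        with body_le_pos_atom[OF r(1) l(2)] show ?thesis by simp
      qed
      then show ?thesis using u by (simp add: U_def)
    qed blast
  qed
  ultimately show False using assms(1) \<open>a \<in> U\<close> unfolding unfounded_free_def by blast
qed

lemma loop_formula_satisfied:
  assumes "tnorm T" "unfounded_free P I" "fset L \<subseteq> atoms P" "L \<noteq> {||}"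
  shows "val I (loop_formula T L P) = 1"
proof -
  let ?F = "FMax (FAtom |`| L)" and ?G = "FMax (body_formula |`| external_rules P L)"
  have "val I ?F \<in> {0..1}"
    using assms(3) interp
    by (intro val_FMax_range) (force simp: interpretation_of_def)
  moreover have "val I ?G \<in> {0..1}"
    using body_range by (intro val_FMax_range) (auto simp: external_rules_def)
  moreover have "val I ?F \<le> val I ?G"
  proof -
    have "FAtom |`| L \<noteq> {||}" using assms(4) by simp
    then obtain F where "F |\<in>| FAtom |`| L" and F: "val I ?F = val I F"
      by (rule val_FMax_attained)
    then obtain a where "a \<in> fset L" "F = FAtom a" by blast
    then have "val I F \<le> val I ?G"
      using loop_atom_le_FMax_external[OF assms(2,3)] by (simp del: val.simps(7))
    then show ?thesis using F by (simp only:)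
  qed
  ultimately have "residual T (val I ?F) (val I ?G) = 1"
    by (simp only: residual_eq_1_iff[OF assms(1)])
  \<comment> \<open>Without external rules the formula has \<open>FConst 0\<close> in place of
    \<open>?G\<close>; the default value of the empty maximum makes the two agree.\<close>
  then show ?thesis by (cases "external_rules P L = {||}") (simp_all add: loop_formula_def)
qed

end

theorem proposition4:
  fixes P :: "'a rule fset"
    and I :: "'a \<Rightarrow> real"
    and T :: "real \<Rightarrow> real \<Rightarrow> real"
    and S :: "'a fset \<Rightarrow> real \<Rightarrow> real \<Rightarrow> real"
  assumes "fasp_program P"
    and "tnorm T"
    and "\<And>L. loop P L \<Longrightarrow> tnorm (S L)"
    and "answer_set P I"
  shows "satisfies I (loop_formulas S P \<union> completion T P)"
proof -
  have "model P I" and uf: "unfounded_free P I"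
    using assms(4) by (auto simp: answer_set_def)
  then have int: "interpretation_of P I"
    and sat: "\<And>r. r \<in> fset P \<Longrightarrow> val I (rule_formula r) = 1"
    by (auto simp: model_def)
  interpret program_interpretation P I
    using assms(1) int by unfold_locales
  have "val I (loop_formula (S L) L P) = 1" if "loop P L" for L
    using that by (intro loop_formula_satisfied assms(3) uf) (auto simp: loop_def)
  moreover have "val I (FEquiv T (FAtom a) (FMax (body_formula |`| rules_for P a))) = 1"
    (is "val I (FEquiv T _ (FMax ?Fs)) = 1") if a: "a \<in> atoms P" for a
  proof -
    have range: "I a \<in> {0..1}" using a int by (auto simp: interpretation_of_def)
    have "val I (FMax ?Fs) \<le> I a"
    \<comment> \<open>With no rule for \<open>a\<close> the maximum is 0. Otherwise it is attained
      at the body of some rule with head \<open>a\<close>, and satisfaction of that rule gives the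
      bound.\<close>
    proof (cases "?Fs = {||}")
      case False
      then obtain F where "F |\<in>| ?Fs" and F: "val I (FMax ?Fs) = val I F"
        by (rule val_FMax_attained)
      then obtain r where r: "r \<in> fset P" "head r = Atom a" "F = body_formula r"
        by (auto simp: rules_for_def)
      then show ?thesis using F sat[of r] rule_satisfied_iff[of r] by simp
    qed (use range in simp)
    then have "val I (FMax ?Fs) = I a"
      using atom_le_FMax_rules[OF uf a] by linarith
    then show ?thesis using biresiduum_self[OF assms(2) range] by (simp del: val.simps(7))
  qed
  \<comment> \<open>For a constant head the completion formula is the rule formula itself.\<close>
  moreover have "val I (FImp (rule_tnorm r) (body_formula r) (FConst c)) = 1"
    if "r \<in> fset P" "head r = Const c" for r c
    using sat[OF that(1)] that(2) by (simp add: rule_formula_def)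
  ultimately show ?thesis
    unfolding satisfies_def loop_formulas_def completion_def by blast
qed

end
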